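(* Let $E\subset\mathbb{R}^2$ be an ellipse centered at $0$. If $A,B\subset\mathbb{R}^2$ are compact and nonconvex, then $$d^{(E)}(A+B)^2=d^{(E)}(A)^2+d^{(E)}(B)^2$$ if and only if the affine hulls $\mathrm{aff}(A)$ and $\mathrm{aff}(B)$ are $E$-orthogonal lines.
   Context: An ellipse centered at $0$ is a set of the form $E=T^{-1}B_2^2$, where $B_2^2$ is the closed Euclidean unit disc in $\mathbb{R}^2$ and $T:\mathbb{R}^2\to\mathbb{R}^2$ is an invertible linear map. The norm with closed unit ball $E$ is $\|x\|_E:=\inf\{\lambda>0: x\in\lambda E\}$. For a nonempty set $S\subset\mathbb{R}^2$, $$d^{(E)}(S):=\sup_{x\in\mathrm{conv}(S)}\ \inf_{s\in S}\|x-s\|_E,$$ where $\mathrm{conv}(S)$ is the convex hull of $S$. The sum $A+B:=\{a+b: a\in A,\ b\in B\}$ is the Minkowski sum, and $\mathrm{aff}(S)$ denotes the affine hull of $S$. Two (affine) lines $L_1,L_2\subset\mathbb{R}^2$ are called $E$-orthogonal if the lines $TL_1$ and $TL_2$ are orthogonal (in the Euclidean sense, i.e. their directions are orthogonal), where $T$ is any invertible linear transformation such that $TE=B_2^2$; this does not depend on the choice of $T$. The condition "$\mathrm{aff}(A)$ and $\mathrm{aff}(B)$ are $E$-orthogonal lines" means that both affine hulls are one-dimensional (lines) and these lines are $E$-orthogonal. A set is nonconvex if it is not convex (in particular it is nonempty). *)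

theory Defs
  imports "HOL-Analysis.Analysis" "HOL-Library.Set_Algebras"
begin

definition ellipse :: "(real^2) set \<Rightarrow> bool" where
  "ellipse E \<longleftrightarrow> (\<exists>T :: real^2 \<Rightarrow> real^2. linear T \<and> bij T \<and> E = T -` cball 0 1)"

definition gauge_norm :: "(real^2) set \<Rightarrow> real^2 \<Rightarrow> real" where
  "gauge_norm E x = Inf {l::real. l > 0 \<and> x \<in> (*\<^sub>R) l ` E}"

text \<open>The supremum and infimum are taken in the reals, so the value of \<^term>\<open>hull_dist\<close> is
  meaningful only for nonempty sets on which they are bounded, for instance nonempty bounded
  sets.\<close>

definition hull_dist :: "(real^2) set \<Rightarrow> (real^2) set \<Rightarrow> real" where
  "hull_dist E S = (SUP x\<in>convex hull S. INF s\<in>S. gauge_norm E (x - s))"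

definition line :: "(real^2) set \<Rightarrow> bool" where
  "line L \<longleftrightarrow> affine L \<and> aff_dim L = 1"

definition orthogonal_lines :: "(real^2) set \<Rightarrow> (real^2) set \<Rightarrow> bool" where
  "orthogonal_lines L M \<longleftrightarrow> line L \<and> line M \<and>
     (\<forall>x\<in>L. \<forall>y\<in>L. \<forall>u\<in>M. \<forall>v\<in>M. orthogonal (x - y) (u - v))"

text \<open>The condition does not depend on the choice of \<open>T\<close>; see \<open>E_orthogonal_lines_iff\<close>.\<close>

definition E_orthogonal_lines :: "(real^2) set \<Rightarrow> (real^2) set \<Rightarrow> (real^2) set \<Rightarrow> bool" where
  "E_orthogonal_lines E L M \<longleftrightarrow> line L \<and> line M \<and>
     (\<exists>T :: real^2 \<Rightarrow> real^2. linear T \<and> bij T \<and> T ` E = cball 0 1 \<and>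
        orthogonal_lines (T ` L) (T ` M))"

lemma line_linear_image:
  assumes "linear T" "bij T" "line L"
  shows "line (T ` L)"
proof -
  have "affine hull (T ` L) = T ` (affine hull L)"
    using assms affine_hull_linear_image linear_conv_bounded_linear by metis
  then show ?thesis
    using assms by (auto simp: line_def bij_is_inj simp flip: affine_hull_eq)
qed

lemma linear_ball_preserving_norm:
  fixes U :: "real^2 \<Rightarrow> real^2"
  assumes U: "linear U" and b: "bij U" and ball: "U ` cball 0 1 = cball 0 1"
  shows "norm (U x) = norm x"
proof -
  have le: "norm (V x) \<le> norm x"
    if V: "linear V" and ball: "V ` cball 0 1 = cball 0 1" for V :: "real^2 \<Rightarrow> real^2" and x
  proof (cases "x = 0")
    case True
    then show ?thesis using linear_0[OF V] by simp
  next
    case False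
    have "V (x /\<^sub>R norm x) \<in> cball 0 1"
      using ball False by (metis imageI mem_cball_0 norm_sgn order_refl sgn_div_norm)
    then show ?thesis using False by (simp add: linear_scale[OF V] field_simps)
  qed
  have "(inv U) ` cball 0 1 = cball 0 1"
    by (metis b ball bij_is_inj image_inv_f_f)
  moreover have "linear (inv U)"
    using U b by (simp add: bij_is_inj inj_linear_imp_inv_linear)
  ultimately have "norm (inv U (U x)) \<le> norm (U x)" by (rule le[rotated])
  then show ?thesis using le[OF U ball, of x] b by (simp add: bij_is_inj)
qed

lemma E_orthogonal_lines_iff:
  fixes T :: "real^2 \<Rightarrow> real^2"
  assumes T: "linear T" "bij T" "T ` E = cball 0 1"
  shows "E_orthogonal_lines E L M \<longleftrightarrow> line L \<and> line M \<and> orthogonal_lines (T ` L) (T ` M)"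
proof
  assume "E_orthogonal_lines E L M"
  then obtain S :: "real^2 \<Rightarrow> real^2" where S: "linear S" "bij S" "S ` E = cball 0 1"
    and L: "line L" "line M" and o: "orthogonal_lines (S ` L) (S ` M)"
    by (auto simp: E_orthogonal_lines_def)
  define U where "U = T \<circ> inv S"
  have U: "linear U" "bij U"
    using S T
    by (auto simp: U_def bij_is_inj inj_linear_imp_inv_linear
        intro!: linear_compose bij_comp bij_imp_bij_inv)
  have US: "U (S x) = T x" for x
    using S by (simp add: U_def bij_is_inj)
  have "U ` cball 0 1 = cball 0 1"
    using US S(3) T(3) by (metis (no_types, lifting) image_cong image_image)
  then have "orthogonal_transformation U"
    using U linear_ball_preserving_norm by (auto simp: orthogonal_transformation)
  then have inner: "U x \<bullet> U y = x \<bullet> y" for x y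
    by (simp add: orthogonal_transformation_def)
  have "orthogonal (T x - T y) (T u - T v)" if "x \<in> L" "y \<in> L" "u \<in> M" "v \<in> M" for x y u v
  proof -
    have "orthogonal (S x - S y) (S u - S v)"
      using o that by (simp add: orthogonal_lines_def)
    then show ?thesis
      by (simp add: orthogonal_def inner flip: US linear_diff[OF U(1)])
  qed
  then show "line L \<and> line M \<and> orthogonal_lines (T ` L) (T ` M)"
    using L T line_linear_image by (auto simp: orthogonal_lines_def)
next
  assume "line L \<and> line M \<and> orthogonal_lines (T ` L) (T ` M)"
  then show "E_orthogonal_lines E L M"
    using T by (auto simp: E_orthogonal_lines_def)
qed

end

theory Submission
  imports Defs
begin

text \<open>
  An invertible linear map carrying \<open>E\<close> to the unit disc reduces everything to the Euclidean norm,
  where \<open>d(S)\<close> is the largest distance from a point of the convex hull of \<open>S\<close> to \<open>S\<close>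
  (\<open>hull_gap\<close>).  If \<open>A\<close> and \<open>B\<close> lie on orthogonal lines, squared distances to \<open>A + B\<close> split as a
  sum by Pythagoras, which gives the equality at once.  The substance is the converse.

  Let \<open>\<alpha> = d(A)\<close>, \<open>\<beta> = d(B)\<close>, and let \<open>x\<close> be a point of the hull of \<open>A + B\<close> at largest distance from
  \<open>A + B\<close>.  Reflecting \<open>B\<close> to \<open>x - B\<close> turns sums into differences: the convex hulls \<open>K\<close> and
  \<open>L\<close> of \<open>A\<close> and of the reflected \<open>B\<close> meet, while every point of \<open>A\<close> has squared distance at least
  \<open>\<alpha>\<^sup>2 + \<beta>\<^sup>2\<close> from every point of \<open>B\<close>.  The task is to show that such an extremal pair is
  a cross, that is, contained in two orthogonal lines.

  No point of \<open>A\<close> lies in \<open>L\<close>, since it would be within \<open>\<beta>\<close> of \<open>B\<close>; likewise no point of \<open>B\<close> lies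
  in \<open>K\<close>.  In the plane this forces some segment \<open>[a, a']\<close> with ends in \<open>A\<close> to meet \<open>L\<close>
  (\<open>segment_meets_convex_set\<close>).  Its line meets \<open>L\<close> only inside the segment, hence misses \<open>B\<close> and
  splits \<open>B\<close> in two parts.  A closest pair \<open>b, b'\<close> across the line has no point of \<open>B\<close> nearer to its
  midpoint than \<open>b\<close> and \<open>b'\<close> themselves, so \<open>|b - b'| \<le> 2 \<beta>\<close>; and the chord \<open>[b, b']\<close> crosses \<open>K\<close>
  (\<open>short_crossing_chord\<close>).

  Let \<open>p\<close> be any point of \<open>K\<close> on such a chord, and let \<open>a\<close> be a point of \<open>A\<close> within \<open>\<alpha>\<close> of \<open>p\<close>.
  Weighting \<open>b\<close> and \<open>b'\<close> so that their mean is \<open>p\<close>, the mean of \<open>|a - b|\<^sup>2\<close> and \<open>|a - b'|\<^sup>2\<close> is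
  \<open>|a - p|\<^sup>2\<close> plus the variance \<open>|p - b| |p - b'| \<le> \<beta>\<^sup>2\<close>, so it is at most
  \<open>\<alpha>\<^sup>2 + \<beta>\<^sup>2\<close>.  Extremality turns all of this into equality: \<open>p\<close> is the midpoint of a chord of
  length exactly \<open>2 \<beta>\<close>, and \<open>a - p\<close> is orthogonal to it (\<open>chord_variance_rigid\<close>).

  Exchanging the two sets gives a chord \<open>[a, a']\<close> of \<open>A\<close> of length \<open>2 \<alpha>\<close>, crossing the
  first chord orthogonally at the common midpoint \<open>p\<close>.  If \<open>A\<close> had a point off the line
  through \<open>a\<close> and \<open>a'\<close>, then \<open>K\<close> would contain further points of \<open>[b, b']\<close> near \<open>p\<close>, and
  these are not its midpoint.  Hence \<open>A\<close> lies on that line, and by symmetry \<open>B\<close> lies on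
  the orthogonal one (\<open>contained_in_line\<close>, \<open>orthogonal_cross\<close>).
\<close>

section \<open>Segments and convex sets in the plane\<close>

lemma parallel_if_common_normal:
  fixes n v w :: "real^2"
  assumes "n \<noteq> 0" "n \<bullet> v = 0" "n \<bullet> w = 0" "v \<noteq> 0"
  shows "\<exists>t. w = t *\<^sub>R v"
proof -
  have 1: "n$1 * v$1 + n$2 * v$2 = 0" "n$1 * w$1 + n$2 * w$2 = 0"
    using assms by (auto simp: inner_vec_def sum_2)
  have "n$1 * (v$1 * w$2 - v$2 * w$1) = 0" "n$2 * (v$1 * w$2 - v$2 * w$1) = 0"
    using 1 by algebra+
  moreover have "n$1 \<noteq> 0 \<or> n$2 \<noteq> 0"
    using assms(1) by (auto simp: vec_eq_iff forall_2)
  ultimately have 2: "v$1 * w$2 = v$2 * w$1" by auto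
  have "v$1 \<noteq> 0 \<or> v$2 \<noteq> 0"
    using assms(4) by (auto simp: vec_eq_iff forall_2)
  then show ?thesis
  proof
    assume "v$1 \<noteq> 0"
    then have "w = (w$1 / v$1) *\<^sub>R v"
      using 2 by (simp add: vec_eq_iff forall_2 field_simps)
    then show ?thesis by blast
  next
    assume "v$2 \<noteq> 0"
    then have "w = (w$2 / v$2) *\<^sub>R v"
      using 2 by (simp add: vec_eq_iff forall_2 field_simps)
    then show ?thesis by blast
  qed
qed

lemma orthogonal_coordinates:
  fixes u v w :: "real^2"
  assumes "u \<noteq> 0" "v \<noteq> 0" "u \<bullet> v = 0"
  obtains s t where "w = s *\<^sub>R u + t *\<^sub>R v"
proof -
  define s where "s = (w \<bullet> u) / (u \<bullet> u)"
  have "u \<bullet> (w - s *\<^sub>R u) = 0"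
    using assms(1) by (simp add: s_def inner_diff_right inner_commute)
  then obtain t where "w - s *\<^sub>R u = t *\<^sub>R v"
    using parallel_if_common_normal assms by metis
  then show ?thesis by (intro that[of s t]) (simp add: algebra_simps)
qed

lemma convex_hull_member_triangle:
  fixes A :: "'a::euclidean_space set"
  assumes "DIM('a) = 2" "p \<in> convex hull A"
  obtains a b c where "a \<in> A" "b \<in> A" "c \<in> A" "p \<in> convex hull {a,b,c}"
proof -
  obtain S where S: "finite S" "S \<subseteq> A" "card S \<le> 3" "p \<in> convex hull S"
    using assms by (subst (asm) caratheodory) auto
  then have "S \<noteq> {}" by auto
  with S have "card S = 1 \<or> card S = 2 \<or> card S = 3"
    by (metis One_nat_def card_gt_0_iff le_Suc_eq le_zero_eq neq0_conv numeral_2_eq_2 numeral_3_eq_3)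
  then have "\<exists>a b c. S = {a,b,c}"
    unfolding card_1_singleton_iff card_2_iff card_3_iff One_nat_def by blast
  then obtain a b c where "S = {a,b,c}" by blast
  with S that[of a b c] show thesis by simp
qed

text \<open>A point of \<open>L\<close> in the hull of \<open>A\<close> lies in a triangle with vertices in \<open>A\<close> by
  Caratheodory's theorem.  As \<open>L\<close> is connected and not contained in the triangle, it meets the
  frontier of the triangle, which in dimension two consists of the three sides.\<close>

lemma segment_meets_convex_set:
  fixes A L :: "'a::euclidean_space set"
  assumes "DIM('a) = 2" "convex L" "convex hull A \<inter> L \<noteq> {}" "\<not> L \<subseteq> convex hull A"
  obtains a a' where "a \<in> A" "a' \<in> A" "closed_segment a a' \<inter> L \<noteq> {}"
proof -
  obtain p y where p: "p \<in> convex hull A" "p \<in> L" and y: "y \<in> L" "y \<notin> convex hull A"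
    using assms by blast
  obtain a b c where abc: "a \<in> A" "b \<in> A" "c \<in> A" "p \<in> convex hull {a,b,c}"
    using convex_hull_member_triangle[OF assms(1) p(1)] .
  have "convex hull {a,b,c} \<subseteq> convex hull A"
    using abc by (intro hull_mono) auto
  then have "L \<inter> frontier (convex hull {a,b,c}) \<noteq> {}"
    using p y abc assms(2) by (intro connected_Int_frontier convex_connected) auto
  then show thesis
    using that abc unfolding frontier_of_triangle[OF assms(1)] by blast
qed

text \<open>A point of \<open>L\<close> on the line beyond \<open>a\<close> or \<open>a'\<close> would put that end between two points
  of \<open>L\<close>.\<close>

lemma line_section_within_segment:
  fixes a a' :: "'a::real_vector"
  assumes L: "convex L" and a: "a \<notin> L" "a' \<notin> L"
    and q: "q \<in> closed_segment a a'" "q \<in> L"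
    and y: "a + s *\<^sub>R (a' - a) \<in> L" (is "?y \<in> L")
  shows "0 \<le> s \<and> s \<le> 1"
proof -
  obtain t where t: "0 \<le> t" "t \<le> 1" "q = (1 - t) *\<^sub>R a + t *\<^sub>R a'"
    using q by (auto simp: in_segment)
  have "(1 - l) *\<^sub>R ?y + l *\<^sub>R q \<in> L" if "0 \<le> l" "l \<le> 1" for l
    using convexD[OF L y q(2), of "1 - l" l] that by auto
  moreover have "(1 - l) *\<^sub>R ?y + l *\<^sub>R q = a + ((1 - l) * s + l * t) *\<^sub>R (a' - a)" for l
    by (simp add: t algebra_simps)
  ultimately have *: "a + ((1 - l) * s + l * t) *\<^sub>R (a' - a) \<in> L" if "0 \<le> l" "l \<le> 1" for l
    using that by simp
  have "\<not> s < 0"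
  proof
    assume s: "s < 0"
    \<comment> \<open>the weights that express \<open>a\<close> as a convex combination of the point beyond it and \<open>q\<close>\<close>
    have "(1 - - s / (t - s)) * s + - s / (t - s) * t = 0"
      using s t by (simp add: field_simps)
    with *[of "- s / (t - s)"] s t a show False
      by (simp add: field_simps)
  qed
  moreover have "\<not> 1 < s"
  proof
    assume s: "1 < s"
    then have "(s - 1) / (s - t) * (s - t) = s - 1" using t by simp
    then have "(1 - (s - 1) / (s - t)) * s + (s - 1) / (s - t) * t = 1"
      by (simp only: left_diff_distrib right_diff_distrib mult_1_left)
    with *[of "(s - 1) / (s - t)"] s t a show False
      by (simp add: field_simps)
  qed
  ultimately show ?thesis by auto
qed

section \<open>Short chords across a line\<close>

text \<open>A function without zeros on \<open>B\<close> splits \<open>B\<close> into two compact parts.  A point of \<open>B\<close> nearer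
  to the midpoint of a closest pair than the two ends are would, by the triangle inequality,
  be nearer to the end on the opposite side than the pair allows.\<close>

lemma closest_pair_across:
  fixes B :: "'a::euclidean_space set" and f :: "'a \<Rightarrow> real"
  assumes B: "compact B" and f: "continuous_on UNIV f" and f0: "\<And>c. c \<in> B \<Longrightarrow> f c \<noteq> 0"
    and ex: "\<exists>c\<in>B. 0 < f c" "\<exists>c\<in>B. f c < 0"
  obtains b b' where "b \<in> B" "b' \<in> B" "0 < f b" "f b' < 0"
    "dist b b' \<le> 2 * infdist (midpoint b b') B"
proof -
  define P where "P = B \<inter> {x. 0 \<le> f x}"
  define N where "N = B \<inter> {x. f x \<le> 0}"
  have "compact P" "compact N"
    using B f unfolding P_def N_def
    by (auto intro!: compact_Int_closed closed_Collect_le continuous_intros)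
  moreover have "P \<noteq> {}" "N \<noteq> {}"
    using ex by (auto simp: P_def N_def intro: less_imp_le)
  ultimately obtain b b' where b: "b \<in> P" "b' \<in> N" "dist b b' = setdist P N"
    using setdist_compact_closed[of P N] compact_imp_closed by blast
  have *: "dist b b' \<le> dist x y" if "x \<in> P" "y \<in> N" for x y
    using that b by (simp add: setdist_le_dist)
  have "B \<noteq> {}" using ex by blast
  then obtain c where c: "c \<in> B" "infdist (midpoint b b') B = dist (midpoint b b') c"
    using infdist_attains_inf[OF compact_imp_closed[OF B]] by metis
  have m: "dist b (midpoint b b') = dist b b' / 2" "dist (midpoint b b') b' = dist b b' / 2"
    by (simp_all add: dist_midpoint)
  have "c \<in> P \<or> c \<in> N" using c by (auto simp: P_def N_def)
  then have "dist b b' \<le> dist b b' / 2 + dist (midpoint b b') c"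
  proof
    assume "c \<in> P"
    then have "dist b b' \<le> dist c b'" using b * by blast
    also have "\<dots> \<le> dist c (midpoint b b') + dist (midpoint b b') b'" by (rule dist_triangle)
    finally show ?thesis using m by (simp add: dist_commute)
  next
    assume "c \<in> N"
    then have "dist b b' \<le> dist b c" using b * by blast
    also have "\<dots> \<le> dist b (midpoint b b') + dist (midpoint b b') c" by (rule dist_triangle)
    finally show ?thesis using m by simp
  qed
  then have "dist b b' \<le> 2 * infdist (midpoint b b') B" using c by simp
  moreover have "b \<in> B" "b' \<in> B" "0 < f b" "f b' < 0"
    using b f0[of b] f0[of b'] by (auto simp: P_def N_def)
  ultimately show thesis using that by blast
qed

text \<open>A sign change of the linear form vanishing on the line through \<open>a\<close> and \<open>a'\<close> supplies the
  splitting of \<open>B\<close>.  The chord joining a closest pair crosses that line inside the hull of \<open>B\<close>, and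
  the line leaves the hull of \<open>B\<close> before it reaches \<open>a\<close> or \<open>a'\<close>.  Thus the crossing point belongs
  to both segments.\<close>

lemma short_crossing_chord:
  fixes B :: "(real^2) set"
  assumes B: "compact B"
    and a: "a \<notin> convex hull B" "a' \<notin> convex hull B"
    and disj: "closed_segment a a' \<inter> B = {}"
    and meet: "closed_segment a a' \<inter> convex hull B \<noteq> {}"
    and gap: "\<And>y. y \<in> convex hull B \<Longrightarrow> infdist y B \<le> \<beta>"
  obtains b b' p where "b \<in> B" "b' \<in> B" "p \<in> closed_segment b b'"
    "p \<in> closed_segment a a'" "dist b b' \<le> 2 * \<beta>"
proof -
  obtain q where q: "q \<in> closed_segment a a'" "q \<in> convex hull B"
    using meet by blast
  have "a \<noteq> a'" using a q by (metis closed_segment_idem singletonD)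
  obtain n where n: "n \<noteq> 0" "orthogonal (a' - a) n"
    using orthogonal_to_vector_exists[of "a' - a"] by auto
  define f where "f y = n \<bullet> (y - a)" for y
  have on_segment: "y \<in> closed_segment a a'" if y: "y \<in> convex hull B" "f y = 0" for y
  proof -
    have "n \<bullet> (a' - a) = 0" "n \<bullet> (y - a) = 0" "a' - a \<noteq> 0"
      using n y \<open>a \<noteq> a'\<close> by (auto simp: orthogonal_def inner_commute f_def)
    then obtain s where s: "y - a = s *\<^sub>R (a' - a)"
      using parallel_if_common_normal n by metis
    then have ys: "y = a + s *\<^sub>R (a' - a)" by (simp add: algebra_simps)
    then have "0 \<le> s \<and> s \<le> 1"
      using line_section_within_segment[OF convex_convex_hull a q] y by blast
    moreover have "y = (1 - s) *\<^sub>R a + s *\<^sub>R a'" using ys by (simp add: algebra_simps)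
    ultimately show ?thesis by (auto simp: in_segment)
  qed
  have f0: "f c \<noteq> 0" if "c \<in> B" for c
    using on_segment[of c] disj that by (auto simp: hull_inc)
  have fq: "f q = 0"
  proof -
    obtain t where "q = (1 - t) *\<^sub>R a + t *\<^sub>R a'"
      using q by (auto simp: in_segment)
    then have "q - a = t *\<^sub>R (a' - a)" by (simp add: algebra_simps)
    then show ?thesis using n by (simp add: f_def orthogonal_def inner_commute)
  qed
  have half: "convex {x. f x < 0}" "convex {x. 0 < f x}"
    using convex_halfspace_lt[of n "n \<bullet> a"] convex_halfspace_gt[of "n \<bullet> a" n]
    by (simp_all add: f_def inner_diff_right)
  have ex: "\<exists>c\<in>B. 0 < f c" "\<exists>c\<in>B. f c < 0"
  proof -
    show "\<exists>c\<in>B. 0 < f c"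
    proof (rule ccontr)
      assume "\<not> ?thesis"
      then have "B \<subseteq> {x. f x < 0}" using f0 by force
      then have "convex hull B \<subseteq> {x. f x < 0}" using half by (intro hull_minimal)
      then show False using q fq by force
    qed
    show "\<exists>c\<in>B. f c < 0"
    proof (rule ccontr)
      assume "\<not> ?thesis"
      then have "B \<subseteq> {x. 0 < f x}" using f0 by force
      then have "convex hull B \<subseteq> {x. 0 < f x}" using half by (intro hull_minimal)
      then show False using q fq by force
    qed
  qed
  have "continuous_on UNIV f"
    unfolding f_def by (intro continuous_intros)
  then obtain b b' where b: "b \<in> B" "b' \<in> B" "0 < f b" "f b' < 0"
    and d: "dist b b' \<le> 2 * infdist (midpoint b b') B"
    using closest_pair_across[OF B _ f0 ex] by metis
  have sub: "closed_segment b b' \<subseteq> convex hull B"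
    using b by (simp add: closed_segment_subset hull_inc)
  then have "infdist (midpoint b b') B \<le> \<beta>"
    using gap midpoint_in_closed_segment by blast
  then have short: "dist b b' \<le> 2 * \<beta>" using d by simp
  define t where "t = f b / (f b - f b')"
  define p where "p = (1 - t) *\<^sub>R b + t *\<^sub>R b'"
  have t: "0 \<le> t" "t \<le> 1" using b by (auto simp: t_def field_simps)
  then have p: "p \<in> closed_segment b b'" by (auto simp: p_def in_segment)
  have "f p = (1 - t) * f b + t * f b'"
    by (simp add: f_def p_def inner_diff_right inner_add_right algebra_simps)
  also have "\<dots> = 0" using b by (simp add: t_def field_simps)
  finally have "p \<in> closed_segment a a'" using on_segment[of p] subsetD[OF sub p] by simp
  then show thesis using that b p short by blast
qed

section \<open>The variance of a chord\<close>

text \<open>The parallel axis theorem for two points \<open>b\<close>, \<open>b'\<close> with weights \<open>1 - t\<close>, \<open>t\<close> and mean \<open>p\<close>;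
  the last summand is their variance.\<close>

lemma chord_variance:
  fixes a b b' :: "'a::real_inner"
  assumes "p = (1 - t) *\<^sub>R b + t *\<^sub>R b'"
  shows "(1 - t) * (dist a b)\<^sup>2 + t * (dist a b')\<^sup>2 = (dist a p)\<^sup>2 + t * (1 - t) * (dist b b')\<^sup>2"
  unfolding assms dist_norm power2_norm_eq_inner
  by (simp add: inner_diff_left inner_diff_right inner_add_left inner_add_right
      inner_commute algebra_simps power2_eq_square)

text \<open>The mean of the two squared distances from \<open>a\<close> is at most \<open>\<alpha>\<^sup>2 + 4 t (1 - t) \<beta>\<^sup>2\<close>, so the
  lower bounds force \<open>t = 1/2\<close> and equality throughout.  Then \<open>a\<close> is equidistant from \<open>b\<close> and \<open>b'\<close>,
  which is the orthogonality.\<close>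

lemma chord_variance_rigid:
  fixes a b b' :: "'a::real_inner"
  assumes p: "p \<in> closed_segment b b'" and chord: "dist b b' \<le> 2 * \<beta>" and a: "dist a p \<le> \<alpha>"
    and \<beta>: "0 < \<beta>"
    and far: "\<alpha>\<^sup>2 + \<beta>\<^sup>2 \<le> (dist a b)\<^sup>2" "\<alpha>\<^sup>2 + \<beta>\<^sup>2 \<le> (dist a b')\<^sup>2"
  shows "p = midpoint b b'" "dist b b' = 2 * \<beta>" "(a - p) \<bullet> (b - p) = 0"
proof -
  obtain t where t: "0 \<le> t" "t \<le> 1" "p = (1 - t) *\<^sub>R b + t *\<^sub>R b'"
    using p by (auto simp: in_segment)
  have d: "(dist b b')\<^sup>2 \<le> 4 * \<beta>\<^sup>2"
    using power_mono[OF chord, of 2] by (simp add: power2_eq_square)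
  have ap: "(dist a p)\<^sup>2 \<le> \<alpha>\<^sup>2"
    using a by (simp add: power_mono)
  have "\<alpha>\<^sup>2 + \<beta>\<^sup>2 = (1 - t) * (\<alpha>\<^sup>2 + \<beta>\<^sup>2) + t * (\<alpha>\<^sup>2 + \<beta>\<^sup>2)"
    by (simp add: algebra_simps)
  also have "\<dots> \<le> (1 - t) * (dist a b)\<^sup>2 + t * (dist a b')\<^sup>2"
    using t far by (intro add_mono mult_left_mono) auto
  also have "\<dots> = (dist a p)\<^sup>2 + t * (1 - t) * (dist b b')\<^sup>2"
    by (rule chord_variance[OF t(3)])
  finally have le: "\<beta>\<^sup>2 \<le> t * (1 - t) * (dist b b')\<^sup>2" using ap by linarith
  also have "\<dots> \<le> t * (1 - t) * (4 * \<beta>\<^sup>2)"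
    using t d by (intro mult_left_mono) auto
  finally have "(1 - 4 * (t * (1 - t))) * \<beta>\<^sup>2 \<le> 0" by (simp add: algebra_simps)
  then have "1 - 4 * (t * (1 - t)) \<le> 0"
    using \<beta> by (simp add: mult_le_0_iff)
  moreover have "1 - 4 * (t * (1 - t)) = (1 - 2 * t)\<^sup>2"
    by (simp add: power2_eq_square algebra_simps)
  ultimately have t2: "t = 1/2" by auto
  then show pm: "p = midpoint b b'"
    unfolding t(3) t2 by (simp add: midpoint_def algebra_simps)
  have d4: "(dist b b')\<^sup>2 = 4 * \<beta>\<^sup>2" using le d t2 by simp
  then have "(dist b b')\<^sup>2 = (2 * \<beta>)\<^sup>2" by simp
  then show "dist b b' = 2 * \<beta>"
    by (rule power2_eq_imp_eq) (use \<beta> in auto)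
  have squeeze: "x = y" if "x + y \<le> 2 * z" "z \<le> x" "z \<le> y" for x y z :: real
    using that by linarith
  have "(dist a b)\<^sup>2 + (dist a b')\<^sup>2 \<le> 2 * (\<alpha>\<^sup>2 + \<beta>\<^sup>2)"
    using chord_variance[OF t(3), of a] ap d4 t2 by simp
  then have eq: "(dist a b)\<^sup>2 = (dist a b')\<^sup>2" using far by (rule squeeze)
  have "p + p = b + b'" using pm by (simp add: midpoint_def flip: scaleR_2)
  then have b': "b' = p - (b - p)" by (simp add: algebra_simps)
  have "(dist a b')\<^sup>2 - (dist a b)\<^sup>2 = 4 * ((a - p) \<bullet> (b - p))"
    unfolding b' dist_norm power2_norm_eq_inner
    by (simp add: inner_diff_left inner_diff_right inner_commute algebra_simps)
  with eq show "(a - p) \<bullet> (b - p) = 0" by simp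
qed

section \<open>Extremal pairs\<close>

text \<open>The situation reached after reflecting the second summand: \<open>\<alpha>\<close> and \<open>\<beta>\<close> bound the
  distances of hull points to the sets, the hulls meet, and the sets are at least
  \<open>sqrt (\<alpha>\<^sup>2 + \<beta>\<^sup>2)\<close> apart.  The conditions are symmetric under exchanging \<open>A, \<alpha>\<close> with \<open>B, \<beta>\<close>, which lets every
  statement below be used in both directions.\<close>

locale extremal_pair =
  fixes A B :: "(real^2) set" and \<alpha> \<beta> :: real
  assumes compact: "compact A" "compact B"
    and gap: "\<And>y. y \<in> convex hull A \<Longrightarrow> infdist y A \<le> \<alpha>"
      "\<And>y. y \<in> convex hull B \<Longrightarrow> infdist y B \<le> \<beta>"
    and pos: "0 < \<alpha>" "0 < \<beta>"
    and far: "\<And>a b. a \<in> A \<Longrightarrow> b \<in> B \<Longrightarrow> \<alpha>\<^sup>2 + \<beta>\<^sup>2 \<le> (dist a b)\<^sup>2"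
    and hulls_meet: "convex hull A \<inter> convex hull B \<noteq> {}"
begin

lemma swap: "extremal_pair B A \<beta> \<alpha>"
proof
  show "\<beta>\<^sup>2 + \<alpha>\<^sup>2 \<le> (dist b a)\<^sup>2" if "b \<in> B" "a \<in> A" for a b
    using far[OF that(2,1)] by (simp add: add.commute dist_commute)
qed (use compact gap pos hulls_meet in \<open>auto simp: Int_commute\<close>)

lemma near_point:
  assumes "y \<in> convex hull A"
  obtains a where "a \<in> A" "dist a y \<le> \<alpha>"
proof -
  have "A \<noteq> {}" using assms by auto
  then show thesis
    using infdist_attains_inf[OF compact_imp_closed[OF compact(1)]] gap(1)[OF assms] that
    by (metis dist_commute)
qed

lemma disjoint_hull: "convex hull A \<inter> B = {}"
proof (rule ccontr)
  assume "\<not> ?thesis"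
  then obtain b where b: "b \<in> B" "b \<in> convex hull A" by blast
  obtain a where a: "a \<in> A" "dist a b \<le> \<alpha>" using near_point b by blast
  then have "(dist a b)\<^sup>2 \<le> \<alpha>\<^sup>2" by (simp add: power_mono)
  then show False using far[OF a(1) b(1)] zero_less_power[OF pos(2), of 2] by linarith
qed

lemma rigid_chord:
  assumes b: "b \<in> B" "b' \<in> B" "dist b b' \<le> 2 * \<beta>"
    and p: "p \<in> closed_segment b b'" "p \<in> convex hull A"
  shows "p = midpoint b b'" "dist b b' = 2 * \<beta>"
    "\<And>a. a \<in> A \<Longrightarrow> dist a p \<le> \<alpha> \<Longrightarrow> (a - p) \<bullet> (b - p) = 0"
proof -
  obtain a where "a \<in> A" "dist a p \<le> \<alpha>" using near_point p by blast
  then show "p = midpoint b b'" "dist b b' = 2 * \<beta>"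
    using chord_variance_rigid[OF p(1) b(3) _ pos(2) far far] b by blast+
  show "(a - p) \<bullet> (b - p) = 0" if "a \<in> A" "dist a p \<le> \<alpha>" for a
    using chord_variance_rigid[OF p(1) b(3) that(2) pos(2) far far] b that by blast
qed

text \<open>Suppose \<open>c\<close> has a nonzero component along \<open>b - p\<close>.  A suitable convex combination of \<open>c\<close> and
  a point of \<open>[a, a']\<close> cancels the component along \<open>a - p\<close>, so it is a point of the chord
  \<open>[b, b']\<close> in the hull of \<open>A\<close> other than the midpoint \<open>p\<close>, against \<open>rigid_chord\<close>.\<close>

lemma contained_in_line:
  assumes b: "b \<in> B" "b' \<in> B" "dist b b' \<le> 2 * \<beta>" "p = midpoint b b'" "b \<noteq> p"
    and a: "a \<in> A" "a' \<in> A" "p = midpoint a a'" "a \<noteq> p"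
    and orth: "(a - p) \<bullet> (b - p) = 0" and c: "c \<in> A"
  shows "\<exists>s. c = p + s *\<^sub>R (a - p)"
proof -
  define u v where "u = a - p" and "v = b - p"
  have uv: "u \<noteq> 0" "v \<noteq> 0" "u \<bullet> v = 0" using assms by (auto simp: u_def v_def)
  obtain s t where st: "c - p = s *\<^sub>R u + t *\<^sub>R v"
    using orthogonal_coordinates[OF uv] .
  have "t = 0"
  proof (rule ccontr)
    assume "t \<noteq> 0"
    \<comment> \<open>with weight \<open>1 / M\<close> on \<open>c\<close>, the cancelling point stays in \<open>[a, a']\<close> and the
      combination stays in \<open>[b, b']\<close>\<close>
    define M where "M = 1 + \<bar>s\<bar> + \<bar>t\<bar>"
    have M: "1 < M" "\<bar>t\<bar> \<le> M" "\<bar>s\<bar> \<le> M - 1" using \<open>t \<noteq> 0\<close> by (auto simp: M_def)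
    have in_seg: "m + r *\<^sub>R (x - m) \<in> closed_segment x x'"
      if "m = midpoint x x'" "\<bar>r\<bar> \<le> 1" for m x x' :: "real^2" and r
    proof -
      have x': "x' = 2 *\<^sub>R m - x" using that(1) by (simp add: midpoint_def)
      have "m + r *\<^sub>R (x - m) = (1 - (1 - r) / 2) *\<^sub>R x + ((1 - r) / 2) *\<^sub>R x'"
        unfolding x' by (simp add: vec_eq_iff field_simps)
      then show ?thesis
        using that(2) unfolding in_segment by (intro exI[of _ "(1 - r) / 2"]) auto
    qed
    define p' where "p' = p + (t / M) *\<^sub>R v"
    have "p' \<in> closed_segment b b'"
      unfolding p'_def v_def using M b(4) by (intro in_seg) auto
    moreover have "p' \<in> convex hull A"
    proof -
      define z where "z = p + (- s / (M - 1)) *\<^sub>R u"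
      have "z \<in> closed_segment a a'"
        unfolding z_def u_def using M a(3) by (intro in_seg) auto
      moreover have "closed_segment a a' \<subseteq> convex hull A"
        using a by (simp add: closed_segment_subset hull_inc)
      ultimately have "(1 - 1 / M) *\<^sub>R z + (1 / M) *\<^sub>R c \<in> convex hull A"
        using M c by (intro convexD[OF convex_convex_hull]) (auto simp: hull_inc)
      moreover have "(1 - 1 / M) *\<^sub>R z + (1 / M) *\<^sub>R c = p'"
      proof -
        have c': "c = p + (s *\<^sub>R u + t *\<^sub>R v)" using st by (simp add: algebra_simps)
        have "(1 - 1 / M) * (- s / (M - 1)) = - s / M"
          using M by (simp add: field_simps)
        then have "(1 - 1 / M) *\<^sub>R z = (1 - 1 / M) *\<^sub>R p + (- s / M) *\<^sub>R u"
          unfolding z_def by (simp only: scaleR_add_right scaleR_scaleR)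
        then show ?thesis
          unfolding p'_def c' by (simp add: algebra_simps)
      qed
      ultimately show ?thesis by simp
    qed
    ultimately have "p' = p" using rigid_chord(1)[OF b(1-3)] b(4) by blast
    then show False using \<open>t \<noteq> 0\<close> uv M by (simp add: p'_def)
  qed
  then have "c = p + s *\<^sub>R u" using st by (simp add: algebra_simps)
  then show ?thesis by (auto simp: u_def)
qed

text \<open>A chord of \<open>B\<close> found from a segment of \<open>A\<close> is itself a segment meeting the hull of \<open>A\<close>, so the
  same argument with the roles exchanged yields a chord of \<open>A\<close> crossing it.  The crossing point
  is then rigid for both chords at once, hence the midpoint of both.\<close>

lemma orthogonal_cross:
  obtains u v p where "u \<bullet> v = 0" "\<And>a. a \<in> A \<Longrightarrow> \<exists>s. a = p + s *\<^sub>R u"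
    "\<And>b. b \<in> B \<Longrightarrow> \<exists>s. b = p + s *\<^sub>R v"
proof -
  interpret sw: extremal_pair B A \<beta> \<alpha> by (rule swap)
  have sub: "closed_segment a a' \<subseteq> convex hull A" if "a \<in> A" "a' \<in> A" for a a'
    using that by (simp add: closed_segment_subset hull_inc)
  have subB: "closed_segment a a' \<subseteq> convex hull B" if "a \<in> B" "a' \<in> B" for a a'
    using that by (simp add: closed_segment_subset hull_inc)
  have "B \<noteq> {}" using hulls_meet by auto
  then have "\<not> convex hull B \<subseteq> convex hull A"
    using disjoint_hull hull_subset[of B convex] by fast
  then obtain a0 a1 where a01: "a0 \<in> A" "a1 \<in> A" "closed_segment a0 a1 \<inter> convex hull B \<noteq> {}"
    using segment_meets_convex_set[OF _ convex_convex_hull hulls_meet] by auto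
  have "a0 \<notin> convex hull B" "a1 \<notin> convex hull B" "closed_segment a0 a1 \<inter> B = {}"
    using a01 sub[OF a01(1,2)] disjoint_hull sw.disjoint_hull by blast+
  then obtain b b' q where b: "b \<in> B" "b' \<in> B" "q \<in> closed_segment b b'"
    "q \<in> closed_segment a0 a1" "dist b b' \<le> 2 * \<beta>"
    using short_crossing_chord[OF compact(2) _ _ _ a01(3) gap(2)] by metis
  have meet: "closed_segment b b' \<inter> convex hull A \<noteq> {}"
    using b sub[OF a01(1,2)] by blast
  have "b \<notin> convex hull A" "b' \<notin> convex hull A" "closed_segment b b' \<inter> A = {}"
    using b subB[OF b(1,2)] disjoint_hull sw.disjoint_hull by blast+
  then obtain a a' p where a: "a \<in> A" "a' \<in> A" "p \<in> closed_segment a a'"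
    "p \<in> closed_segment b b'" "dist a a' \<le> 2 * \<alpha>"
    using short_crossing_chord[OF compact(1) _ _ _ meet gap(1)] by metis
  have pK: "p \<in> convex hull A" and pL: "p \<in> convex hull B"
    using a b sub subB by blast+
  note rb = rigid_chord[OF b(1,2,5) a(4) pK]
  note ra = sw.rigid_chord[OF a(1,2,5) a(3) pL]
  have da: "dist a p = \<alpha>"
    unfolding ra(1) using ra(2) by (simp add: dist_midpoint)
  have db: "dist b p = \<beta>"
    unfolding rb(1) using rb(2) by (simp add: dist_midpoint)
  have ne: "a \<noteq> p" "b \<noteq> p" using da db pos by auto
  have o: "(a - p) \<bullet> (b - p) = 0" using rb(3) a(1) da by simp
  show thesis
  proof (rule that[OF o])
    show "\<exists>s. c = p + s *\<^sub>R (a - p)" if "c \<in> A" for c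
      using contained_in_line[OF b(1,2,5) rb(1) ne(2) a(1,2) ra(1) ne(1) o that] .
    show "\<exists>s. c = p + s *\<^sub>R (b - p)" if "c \<in> B" for c
      using sw.contained_in_line[OF a(1,2,5) ra(1) ne(1) b(1,2) rb(1) ne(2) _ that] o
      by (simp add: inner_commute)
  qed
qed

end

section \<open>Distance to the convex hull in the Euclidean norm\<close>

definition hull_gap :: "'a::euclidean_space set \<Rightarrow> real" where
  "hull_gap S = (SUP x\<in>convex hull S. infdist x S)"

lemma compact_set_plus:
  fixes A B :: "'a::real_normed_vector set"
  assumes "compact A" "compact B"
  shows "compact (A + B)"
proof -
  have "A + B = {a + b |a b. a \<in> A \<and> b \<in> B}" by (auto simp: set_plus_def)
  then show ?thesis using compact_sums[OF assms] by simp
qed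

lemma hull_gap_attained:
  fixes S :: "'a::euclidean_space set"
  assumes "compact S" "S \<noteq> {}"
  obtains x where "x \<in> convex hull S" "infdist x S = hull_gap S"
    "\<And>y. y \<in> convex hull S \<Longrightarrow> infdist y S \<le> hull_gap S"
proof -
  have "compact (convex hull S)" "convex hull S \<noteq> {}"
    using assms by (auto simp: compact_convex_hull)
  moreover have "continuous_on (convex hull S) (\<lambda>x. infdist x S)"
    by (intro continuous_intros)
  ultimately obtain x where x: "x \<in> convex hull S"
    "\<And>y. y \<in> convex hull S \<Longrightarrow> infdist y S \<le> infdist x S"
    using continuous_attains_sup[of "convex hull S" "\<lambda>x. infdist x S"] by blast
  moreover have "hull_gap S = infdist x S"
    unfolding hull_gap_def using x by (intro cSup_eq_maximum) auto
  ultimately show thesis using that by simp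
qed

lemma hull_gap_pos:
  fixes S :: "'a::euclidean_space set"
  assumes "compact S" "\<not> convex S"
  shows "0 < hull_gap S"
proof -
  have "S \<noteq> {}" using assms(2) by auto
  obtain y where y: "y \<in> convex hull S" "y \<notin> S"
    using assms(2) by (metis convex_hull_eq hull_subset subsetI subset_antisym)
  then have "0 < infdist y S"
    using infdist_pos_not_in_closed[OF compact_imp_closed[OF assms(1)] \<open>S \<noteq> {}\<close>] by blast
  also have "\<dots> \<le> hull_gap S"
    using hull_gap_attained[OF assms(1) \<open>S \<noteq> {}\<close>] y by metis
  finally show ?thesis .
qed

lemma affine_hull_in_line:
  fixes A :: "'a::real_vector set"
  assumes "\<And>a. a \<in> A \<Longrightarrow> \<exists>s. a = p + s *\<^sub>R u" "x \<in> affine hull A"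
  shows "\<exists>s. x = p + s *\<^sub>R u"
proof -
  have "affine (range (\<lambda>s. p + s *\<^sub>R u))"
    unfolding affine_def
  proof clarify
    fix s t l m :: real assume "l + m = 1"
    then have m: "m = 1 - l" by simp
    have "l *\<^sub>R (p + s *\<^sub>R u) + m *\<^sub>R (p + t *\<^sub>R u) = p + (l * s + m * t) *\<^sub>R u"
      unfolding m by (simp add: algebra_simps)
    then show "l *\<^sub>R (p + s *\<^sub>R u) + m *\<^sub>R (p + t *\<^sub>R u) \<in> range (\<lambda>s. p + s *\<^sub>R u)"
      by blast
  qed
  moreover have "A \<subseteq> range (\<lambda>s. p + s *\<^sub>R u)" using assms(1) by blast
  ultimately have "affine hull A \<subseteq> range (\<lambda>s. p + s *\<^sub>R u)" by (intro hull_minimal)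
  then show ?thesis using assms(2) by blast
qed

lemma line_affine_hull:
  fixes A :: "(real^2) set"
  assumes "\<not> convex A" "\<And>a. a \<in> A \<Longrightarrow> \<exists>s. a = p + s *\<^sub>R u"
  shows "line (affine hull A)"
proof -
  have "collinear A"
    unfolding collinear_def
  proof (intro exI[of _ u] ballI)
    fix x y assume "x \<in> A" "y \<in> A"
    then obtain s t where "x = p + s *\<^sub>R u" "y = p + t *\<^sub>R u" using assms(2) by blast
    then have "x - y = (s - t) *\<^sub>R u" by (simp add: algebra_simps)
    then show "\<exists>c. x - y = c *\<^sub>R u" by blast
  qed
  then have "aff_dim A \<le> 1" by (simp add: collinear_aff_dim)
  moreover have "aff_dim A \<noteq> 0" "aff_dim A \<noteq> -1"
    using assms(1) by (auto simp: aff_dim_eq_0 simp flip: aff_dim_empty)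
  ultimately have "aff_dim A = 1" using aff_dim_geq[of A] by linarith
  then show ?thesis by (simp add: line_def aff_dim_affine_hull)
qed

lemma orthogonal_linesI:
  fixes A B :: "(real^2) set"
  assumes "\<not> convex A" "\<not> convex B" "u \<bullet> v = 0"
    and A: "\<And>a. a \<in> A \<Longrightarrow> \<exists>s. a = p + s *\<^sub>R u" and B: "\<And>b. b \<in> B \<Longrightarrow> \<exists>s. b = q + s *\<^sub>R v"
  shows "orthogonal_lines (affine hull A) (affine hull B)"
  unfolding orthogonal_lines_def
proof (intro conjI ballI)
  show "line (affine hull A)" "line (affine hull B)"
    using assms line_affine_hull by blast+
  fix x y z w assume "x \<in> affine hull A" "y \<in> affine hull A" "z \<in> affine hull B" "w \<in> affine hull B"
  then obtain s t l m where "x = p + s *\<^sub>R u" "y = p + t *\<^sub>R u" "z = q + l *\<^sub>R v" "w = q + m *\<^sub>R v"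
    using affine_hull_in_line[OF A] affine_hull_in_line[OF B] by meson
  then have "x - y = (s - t) *\<^sub>R u" "z - w = (l - m) *\<^sub>R v" by (simp_all add: algebra_simps)
  then show "orthogonal (x - y) (z - w)" using assms(3) by (simp add: orthogonal_def)
qed

text \<open>For a point \<open>x\<close> of the hull of \<open>A + B\<close> farthest from \<open>A + B\<close>, the sets \<open>A\<close> and \<open>x - B\<close> form an
  extremal pair: a decomposition of \<open>x\<close> into hull points of \<open>A\<close> and \<open>B\<close> gives a common point of their
  hulls, and the distance of \<open>a\<close> from \<open>x - b\<close> is that of \<open>x\<close> from \<open>a + b\<close>.\<close>

lemma orthogonal_lines_if_hull_gap_ge:
  fixes A B :: "(real^2) set"
  assumes A: "compact A" "\<not> convex A" and B: "compact B" "\<not> convex B"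
    and ge: "(hull_gap A)\<^sup>2 + (hull_gap B)\<^sup>2 \<le> (hull_gap (A + B))\<^sup>2"
  shows "orthogonal_lines (affine hull A) (affine hull B)"
proof -
  have ne: "A \<noteq> {}" "B \<noteq> {}" using A B by auto
  then have "A + B \<noteq> {}" by (auto simp: set_plus_def)
  moreover have "compact (A + B)" using A B by (simp add: compact_set_plus)
  ultimately obtain x where x: "x \<in> convex hull (A + B)" "infdist x (A + B) = hull_gap (A + B)"
    using hull_gap_attained by metis
  define R where "R y = x - y" for y
  have R: "R = (\<lambda>y. x + (-1) *\<^sub>R y)" by (auto simp: R_def)
  have hull: "convex hull (R ` B) = R ` (convex hull B)"
    unfolding R by (rule convex_hull_affinity)
  have gapA: "infdist y A \<le> hull_gap A" if "y \<in> convex hull A" for y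
    using hull_gap_attained[OF A(1) ne(1)] that by metis
  have gapB: "infdist y B \<le> hull_gap B" if "y \<in> convex hull B" for y
    using hull_gap_attained[OF B(1) ne(2)] that by metis
  have inf: "infdist (R y) (R ` B) = infdist y B" for y
    using ne(2) by (simp add: infdist_def R_def image_image dist_norm norm_minus_commute)
  interpret extremal_pair A "R ` B" "hull_gap A" "hull_gap B"
  proof
    show "compact A" "0 < hull_gap A" "0 < hull_gap B"
      using A B hull_gap_pos by auto
    show "compact (R ` B)"
      unfolding R by (intro compact_affinity B)
    show "infdist y A \<le> hull_gap A" if "y \<in> convex hull A" for y
      by (rule gapA[OF that])
    show "infdist y (R ` B) \<le> hull_gap B" if "y \<in> convex hull (R ` B)" for y
      using that gapB inf unfolding hull by auto
    show "(hull_gap A)\<^sup>2 + (hull_gap B)\<^sup>2 \<le> (dist a b)\<^sup>2" if "a \<in> A" "b \<in> R ` B" for a b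
    proof -
      obtain b0 where b0: "b0 \<in> B" "b = x - b0" using \<open>b \<in> R ` B\<close> by (auto simp: R_def)
      have "hull_gap (A + B) \<le> dist x (a + b0)"
        using b0 that x(2) by (metis infdist_le set_plus_intro)
      also have "\<dots> = dist a b"
        by (simp add: b0 dist_norm norm_minus_commute algebra_simps)
      finally have "(hull_gap (A + B))\<^sup>2 \<le> (dist a b)\<^sup>2"
        using x(2) infdist_nonneg by (metis power_mono)
      then show ?thesis using ge by simp
    qed
    obtain a b where "a \<in> convex hull A" "b \<in> convex hull B" "x = a + b"
      using x(1) unfolding convex_hull_set_plus by (rule set_plus_elim)
    then have "a = R b" "a \<in> convex hull A" "b \<in> convex hull B" by (auto simp: R_def)
    then show "convex hull A \<inter> convex hull (R ` B) \<noteq> {}"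
      unfolding hull by blast
  qed
  obtain u v p where *: "u \<bullet> v = 0" "\<And>a. a \<in> A \<Longrightarrow> \<exists>s. a = p + s *\<^sub>R u"
    "\<And>b. b \<in> R ` B \<Longrightarrow> \<exists>s. b = p + s *\<^sub>R v"
    using orthogonal_cross by metis
  show ?thesis
  proof (rule orthogonal_linesI[OF A(2) B(2) *(1,2)])
    show "\<exists>s. b = (x - p) + s *\<^sub>R v" if "b \<in> B" for b
    proof -
      have "R b \<in> R ` B" using that by (rule imageI)
      then obtain s where "R b = p + s *\<^sub>R v" using *(3) by blast
      then have "b = (x - p) + (- s) *\<^sub>R v" by (simp add: R_def algebra_simps)
      then show ?thesis by blast
    qed
  qed
qed

text \<open>Since \<open>|x + y - (a + b)|\<^sup>2 = |x - a|\<^sup>2 + |y - b|\<^sup>2\<close> for all \<open>a\<close> and \<open>b\<close>, the two summands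
  can be minimised independently.\<close>

lemma infdist_plus_orthogonal:
  fixes A B :: "'a::euclidean_space set"
  assumes "closed A" "A \<noteq> {}" "closed B" "B \<noteq> {}" "closed (A + B)"
    and orth: "\<And>a b. a \<in> A \<Longrightarrow> b \<in> B \<Longrightarrow> orthogonal (x - a) (y - b)"
  shows "(infdist (x + y) (A + B))\<^sup>2 = (infdist x A)\<^sup>2 + (infdist y B)\<^sup>2"
proof -
  have pyth: "(dist (x + y) (a + b))\<^sup>2 = (dist x a)\<^sup>2 + (dist y b)\<^sup>2" if "a \<in> A" "b \<in> B" for a b
    using norm_add_Pythagorean[OF orth[OF that]] by (simp add: dist_norm add_diff_add)
  obtain a b where ab: "a \<in> A" "infdist x A = dist x a" "b \<in> B" "infdist y B = dist y b"
    using infdist_attains_inf assms(1-4) by metis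
  have "A + B \<noteq> {}" using assms(2,4) by (auto simp: set_plus_def)
  then obtain c where "c \<in> A + B" "infdist (x + y) (A + B) = dist (x + y) c"
    using infdist_attains_inf assms(5) by metis
  then obtain a' b' where ab': "a' \<in> A" "b' \<in> B" "infdist (x + y) (A + B) = dist (x + y) (a' + b')"
    by (auto elim!: set_plus_elim)
  have "infdist (x + y) (A + B) \<le> dist (x + y) (a + b)"
    using ab by (intro infdist_le) (auto intro: set_plus_intro)
  then have "(infdist (x + y) (A + B))\<^sup>2 \<le> (infdist x A)\<^sup>2 + (infdist y B)\<^sup>2"
    using pyth[OF ab(1,3)] ab power_mono[OF _ infdist_nonneg] by metis
  moreover have "(infdist x A)\<^sup>2 + (infdist y B)\<^sup>2 \<le> (infdist (x + y) (A + B))\<^sup>2"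
    unfolding ab'(3) pyth[OF ab'(1,2)]
    using ab' by (intro add_mono power_mono infdist_le infdist_nonneg)
  ultimately show ?thesis by simp
qed

lemma hull_gap_plus_orthogonal:
  fixes A B :: "(real^2) set"
  assumes A: "compact A" "A \<noteq> {}" and B: "compact B" "B \<noteq> {}"
    and o: "orthogonal_lines (affine hull A) (affine hull B)"
  shows "(hull_gap (A + B))\<^sup>2 = (hull_gap A)\<^sup>2 + (hull_gap B)\<^sup>2"
proof -
  have C: "compact (A + B)" using A B by (simp add: compact_set_plus)
  have C': "A + B \<noteq> {}" using A B by (auto simp: set_plus_def)
  have *: "(infdist (x + y) (A + B))\<^sup>2 = (infdist x A)\<^sup>2 + (infdist y B)\<^sup>2"
    if "x \<in> convex hull A" "y \<in> convex hull B" for x y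
  proof (rule infdist_plus_orthogonal)
    show "orthogonal (x - a) (y - b)" if "a \<in> A" "b \<in> B" for a b
      using o that \<open>x \<in> _\<close> \<open>y \<in> _\<close> convex_hull_subset_affine_hull[of A]
        convex_hull_subset_affine_hull[of B]
      unfolding orthogonal_lines_def by (meson hull_inc subsetD)
  qed (use A B C in \<open>auto simp: compact_imp_closed\<close>)
  obtain x where x: "x \<in> convex hull A" "infdist x A = hull_gap A"
    and gA: "\<And>y. y \<in> convex hull A \<Longrightarrow> infdist y A \<le> hull_gap A"
    using hull_gap_attained[OF A] by blast
  obtain y where y: "y \<in> convex hull B" "infdist y B = hull_gap B"
    and gB: "\<And>y. y \<in> convex hull B \<Longrightarrow> infdist y B \<le> hull_gap B"
    using hull_gap_attained[OF B] by blast
  obtain z where z: "z \<in> convex hull (A + B)" "infdist z (A + B) = hull_gap (A + B)"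
    and gC: "\<And>y. y \<in> convex hull (A + B) \<Longrightarrow> infdist y (A + B) \<le> hull_gap (A + B)"
    using hull_gap_attained[OF C C'] by blast
  obtain x' y' where z': "x' \<in> convex hull A" "y' \<in> convex hull B" "z = x' + y'"
    using z(1) unfolding convex_hull_set_plus by (rule set_plus_elim)
  have "(hull_gap (A + B))\<^sup>2 = (infdist x' A)\<^sup>2 + (infdist y' B)\<^sup>2"
    using * z' z(2) by metis
  also have "\<dots> \<le> (hull_gap A)\<^sup>2 + (hull_gap B)\<^sup>2"
    using z' gA gB by (intro add_mono power_mono infdist_nonneg)
  finally have "(hull_gap (A + B))\<^sup>2 \<le> (hull_gap A)\<^sup>2 + (hull_gap B)\<^sup>2" .
  moreover have "x + y \<in> convex hull (A + B)"
    unfolding convex_hull_set_plus using x y by (intro set_plus_intro)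
  then have "(infdist (x + y) (A + B))\<^sup>2 \<le> (hull_gap (A + B))\<^sup>2"
    using gC infdist_nonneg by (metis power_mono)
  then have "(hull_gap A)\<^sup>2 + (hull_gap B)\<^sup>2 \<le> (hull_gap (A + B))\<^sup>2"
    using *[OF x(1) y(1)] x y by simp
  ultimately show ?thesis by simp
qed

section \<open>Reduction of an ellipse to the unit disc\<close>

lemma gauge_norm_preimage_ball:
  fixes T :: "real^2 \<Rightarrow> real^2"
  assumes T: "linear T"
  shows "gauge_norm (T -` cball 0 1) x = norm (T x)"
proof -
  have mem: "x \<in> (*\<^sub>R) l ` (T -` cball 0 1) \<longleftrightarrow> norm (T x) \<le> l" if "0 < l" for l
  proof
    assume "x \<in> (*\<^sub>R) l ` (T -` cball 0 1)"
    then obtain y where "x = l *\<^sub>R y" "norm (T y) \<le> 1" by force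
    then show "norm (T x) \<le> l"
      using that by (simp add: linear_scale[OF T] mult_left_le)
  next
    assume "norm (T x) \<le> l"
    then have "x /\<^sub>R l \<in> T -` cball 0 1"
      using that by (simp add: linear_scale[OF T] field_simps)
    moreover have "x = l *\<^sub>R (x /\<^sub>R l)" using that by simp
    ultimately show "x \<in> (*\<^sub>R) l ` (T -` cball 0 1)" by blast
  qed
  then have "{l. 0 < l \<and> x \<in> (*\<^sub>R) l ` (T -` cball 0 1)} = {l. 0 < l \<and> norm (T x) \<le> l}"
    by blast
  moreover have "Inf {l. 0 < l \<and> norm (T x) \<le> l} = norm (T x)"
  proof (rule cInf_eq_non_empty)
    have pos: "0 < norm (T x) + e" if "0 < e" for e
      using that by (simp add: add_nonneg_pos)
    show "{l. 0 < l \<and> norm (T x) \<le> l} \<noteq> {}"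
      using pos[of 1] by (auto intro!: exI[of _ "norm (T x) + 1"])
    show "y \<le> norm (T x)" if "\<And>l. l \<in> {l. 0 < l \<and> norm (T x) \<le> l} \<Longrightarrow> y \<le> l" for y
    proof (rule field_le_epsilon)
      show "y \<le> norm (T x) + e" if "0 < e" for e
        using \<open>\<And>l. _ \<Longrightarrow> y \<le> l\<close>[of "norm (T x) + e"] pos that by simp
    qed
  qed auto
  ultimately show ?thesis by (simp add: gauge_norm_def)
qed

lemma hull_dist_eq_hull_gap:
  fixes T :: "real^2 \<Rightarrow> real^2"
  assumes T: "linear T" and "S \<noteq> {}"
  shows "hull_dist (T -` cball 0 1) S = hull_gap (T ` S)"
proof -
  have "convex hull (T ` S) = T ` (convex hull S)"
    using T by (simp add: convex_hull_linear_image)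
  then show ?thesis
    using assms unfolding hull_dist_def hull_gap_def
    by (simp add: gauge_norm_preimage_ball infdist_def image_image dist_norm linear_diff)
qed

theorem theorem1p2:
  fixes A B E :: "(real^2) set"
  assumes "ellipse E"
    and "compact A" and "\<not> convex A"
    and "compact B" and "\<not> convex B"
  shows "(hull_dist E (A + B))\<^sup>2 = (hull_dist E A)\<^sup>2 + (hull_dist E B)\<^sup>2
    \<longleftrightarrow> E_orthogonal_lines E (affine hull A) (affine hull B)"
proof -
  obtain T :: "real^2 \<Rightarrow> real^2" where T: "linear T" "bij T" and E: "E = T -` cball 0 1"
    using assms(1) by (auto simp: ellipse_def)
  have TE: "T ` E = cball 0 1"
    using T(2) E by (simp add: bij_is_surj surj_image_vimage_eq)
  have inj: "inj T" using T(2) by (rule bij_is_inj)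
  have ne: "A \<noteq> {}" "B \<noteq> {}" using assms by auto
  have plus: "T ` (A + B) = T ` A + T ` B"
  proof
    show "T ` (A + B) \<subseteq> T ` A + T ` B"
      by (auto elim!: set_plus_elim simp: linear_add[OF T(1)] intro!: set_plus_intro)
    show "T ` A + T ` B \<subseteq> T ` (A + B)"
    proof
      fix z assume "z \<in> T ` A + T ` B"
      then obtain a b where "a \<in> A" "b \<in> B" "z = T a + T b" by (auto elim!: set_plus_elim)
      then have "a + b \<in> A + B" "z = T (a + b)" by (simp_all add: linear_add[OF T(1)] set_plus_intro)
      then show "z \<in> T ` (A + B)" by blast
    qed
  qed
  have cpt: "compact (T ` A)" "compact (T ` B)"
    using assms T(1) by (simp_all add: compact_continuous_image linear_continuous_on linear_conv_bounded_linear)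
  have nc: "\<not> convex (T ` A)" "\<not> convex (T ` B)"
    using assms T(1) inj by (simp_all add: convex_linear_image_eq)
  have hull: "T ` (affine hull S) = affine hull (T ` S)" for S
    using T(1) by (simp add: affine_hull_linear_image linear_conv_bounded_linear)
  have line: "line (affine hull S) \<longleftrightarrow> line (affine hull (T ` S))" for S
    using T(1) inj by (simp add: line_def aff_dim_affine_hull)
  have "E_orthogonal_lines E (affine hull A) (affine hull B) \<longleftrightarrow>
      orthogonal_lines (affine hull (T ` A)) (affine hull (T ` B))"
    unfolding E_orthogonal_lines_iff[OF T TE] hull line[of A] line[of B] orthogonal_lines_def by blast
  moreover have "A + B \<noteq> {}" using ne by (auto simp: set_plus_def)
  ultimately show ?thesis
    using orthogonal_lines_if_hull_gap_ge[OF cpt(1) nc(1) cpt(2) nc(2)]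
      hull_gap_plus_orthogonal[OF cpt(1) _ cpt(2)] ne
    unfolding E hull_dist_eq_hull_gap[OF T(1) ne(1)] hull_dist_eq_hull_gap[OF T(1) ne(2)]
      hull_dist_eq_hull_gap[OF T(1) \<open>A + B \<noteq> {}\<close>] plus
    by auto
qed

end
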